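(* Let $X$ be an implicative involutive BE algebra. Then the following are equivalent: (a) $X$ is an implicative-orthomodular lattice; (b) for all $x,y\in X$, $((x^*\to y^* )\to(x^*\to y)^* )^*=x^*\to(x\Cap y^* )$.
   Context: A BE algebra is an algebra $(X,\to,1)$ of type $(2,0)$ such that for all $x,y,z\in X$: $x\to x=1$; $x\to 1=1$; $1\to x=x$; $x\to(y\to z)=y\to(x\to z)$. Write $x\le y$ iff $x\to y=1$. It is bounded if there is $0\in X$ with $0\le x$ for all $x\in X$; then $x^*:=x\to 0$. A bounded BE algebra is involutive if $x^{**}=x$ for all $x$. A BE algebra is implicative if $(x\to y)\to x=x$ for all $x,y$. In an involutive BE algebra put $x\Cap y:=((x^*\to y^* )\to y^* )^*$. An implicative-orthomodular lattice is an implicative involutive BE algebra satisfying $x\Cap(y\to x)=x$ for all $x,y$. *)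

theory Defs
  imports "HOL-Algebra.Congruence"
begin

text \<open>
  The bottom element is a component of the structure, so that the complement can refer to it;
  it carries no meaning before \<open>bounded_BE_algebra\<close>. In an involutive BE algebra the bottom
  element is unique, so fixing it there loses nothing.
\<close>

record 'a BE_structure = "'a partial_object" +
  imp :: "'a \<Rightarrow> 'a \<Rightarrow> 'a" (infixr \<open>\<leadsto>\<index>\<close> 70)
  unit :: 'a (\<open>\<one>\<index>\<close>)
  bottom :: 'a (\<open>\<zero>\<index>\<close>)

definition BE_le :: "('a, 'm) BE_structure_scheme \<Rightarrow> 'a \<Rightarrow> 'a \<Rightarrow> bool" (infix \<open>\<preceq>\<index>\<close> 50)
  where "x \<preceq>\<^bsub>X\<^esub> y \<longleftrightarrow> x \<leadsto>\<^bsub>X\<^esub> y = \<one>\<^bsub>X\<^esub>"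

definition BE_compl :: "('a, 'm) BE_structure_scheme \<Rightarrow> 'a \<Rightarrow> 'a" (\<open>_\<^sup>\<star>\<index>\<close> [1000] 1000)
  where "x\<^sup>\<star>\<^bsub>X\<^esub> = x \<leadsto>\<^bsub>X\<^esub> \<zero>\<^bsub>X\<^esub>"

definition BE_Cap :: "('a, 'm) BE_structure_scheme \<Rightarrow> 'a \<Rightarrow> 'a \<Rightarrow> 'a" (infixl \<open>\<sqinter>\<index>\<close> 75)
  where "x \<sqinter>\<^bsub>X\<^esub> y = ((x\<^sup>\<star>\<^bsub>X\<^esub> \<leadsto>\<^bsub>X\<^esub> y\<^sup>\<star>\<^bsub>X\<^esub>) \<leadsto>\<^bsub>X\<^esub> y\<^sup>\<star>\<^bsub>X\<^esub>)\<^sup>\<star>\<^bsub>X\<^esub>"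

locale BE_algebra =
  fixes X :: "('a, 'm) BE_structure_scheme" (structure)
  assumes imp_closed: "\<lbrakk>x \<in> carrier X; y \<in> carrier X\<rbrakk> \<Longrightarrow> x \<leadsto> y \<in> carrier X"
    and unit_closed: "\<one> \<in> carrier X"
    and imp_refl: "x \<in> carrier X \<Longrightarrow> x \<leadsto> x = \<one>"
    and imp_unit_right: "x \<in> carrier X \<Longrightarrow> x \<leadsto> \<one> = \<one>"
    and imp_unit_left: "x \<in> carrier X \<Longrightarrow> \<one> \<leadsto> x = x"
    and imp_exchange: "\<lbrakk>x \<in> carrier X; y \<in> carrier X; z \<in> carrier X\<rbrakk>
      \<Longrightarrow> x \<leadsto> (y \<leadsto> z) = y \<leadsto> (x \<leadsto> z)"

locale bounded_BE_algebra = BE_algebra +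
  assumes bottom_closed: "\<zero> \<in> carrier X"
    and bottom_le: "x \<in> carrier X \<Longrightarrow> \<zero> \<preceq> x"

locale involutive_BE_algebra = bounded_BE_algebra +
  assumes involutive: "x \<in> carrier X \<Longrightarrow> x\<^sup>\<star>\<^sup>\<star> = x"

locale implicative_BE_algebra = BE_algebra +
  assumes implicative: "\<lbrakk>x \<in> carrier X; y \<in> carrier X\<rbrakk> \<Longrightarrow> (x \<leadsto> y) \<leadsto> x = x"

locale implicative_involutive_BE_algebra =
  involutive_BE_algebra + implicative_BE_algebra

locale implicative_orthomodular_lattice = implicative_involutive_BE_algebra +
  assumes orthomodular: "\<lbrakk>x \<in> carrier X; y \<in> carrier X\<rbrakk> \<Longrightarrow> x \<sqinter> (y \<leadsto> x) = x"

end

theory Submission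
  imports Defs
begin

text \<open>
  With join \<open>x\<^sup>\<star> \<leadsto> y\<close> and meet \<open>(x \<leadsto> y\<^sup>\<star>)\<^sup>\<star>\<close>, an implicative involutive BE algebra is an ortholattice:
  exchange and contraposition give commutativity and associativity, and implicativity is the
  absorption law. Since \<open>x \<sqinter> y\<close> is \<open>(x \<or> y\<^sup>\<star>) \<and> y\<close>, condition (a) is the orthomodular law
  \<open>(x \<or> y) \<and> (x \<or> (x \<or> y)\<^sup>\<star>) = x\<close>, while (b) reads \<open>(x \<or> y\<^sup>\<star>) \<and> (x \<or> y) = x \<or> ((x \<or> y) \<and> y\<^sup>\<star>)\<close>.
  Putting \<open>x \<or> y\<close> for \<open>y\<close> in (b) yields (a). Conversely, the right-hand side \<open>w\<close> of (b) lies
  below the left-hand side \<open>m\<close>, and the orthomodular law gives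
  \<open>m \<and> w\<^sup>\<star> = (x \<or> y\<^sup>\<star>) \<and> x\<^sup>\<star> \<and> y = 0\<close>, which forces \<open>w = m\<close>.
\<close>

context implicative_involutive_BE_algebra
begin

definition join :: "'a \<Rightarrow> 'a \<Rightarrow> 'a" (infixl "\<squnion>" 65)
  where "x \<squnion> y = x\<^sup>\<star> \<leadsto> y"

definition meet :: "'a \<Rightarrow> 'a \<Rightarrow> 'a" (infixl "\<sqdot>" 70)
  where "x \<sqdot> y = (x \<leadsto> y\<^sup>\<star>)\<^sup>\<star>"

lemma compl_closed [simp]: "x \<in> carrier X \<Longrightarrow> x\<^sup>\<star> \<in> carrier X"
  by (simp add: BE_compl_def imp_closed bottom_closed)

lemma join_closed [simp]: "\<lbrakk>x \<in> carrier X; y \<in> carrier X\<rbrakk> \<Longrightarrow> x \<squnion> y \<in> carrier X"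
  by (simp add: join_def imp_closed)

lemma meet_closed [simp]: "\<lbrakk>x \<in> carrier X; y \<in> carrier X\<rbrakk> \<Longrightarrow> x \<sqdot> y \<in> carrier X"
  by (simp add: meet_def imp_closed)

lemma compl_join [simp]: "\<lbrakk>x \<in> carrier X; y \<in> carrier X\<rbrakk> \<Longrightarrow> (x \<squnion> y)\<^sup>\<star> = x\<^sup>\<star> \<sqdot> y\<^sup>\<star>"
  by (simp add: join_def meet_def involutive)

lemma compl_meet [simp]: "\<lbrakk>x \<in> carrier X; y \<in> carrier X\<rbrakk> \<Longrightarrow> (x \<sqdot> y)\<^sup>\<star> = x\<^sup>\<star> \<squnion> y\<^sup>\<star>"
  by (simp add: join_def meet_def involutive imp_closed)

lemma imp_compl_commute:
  "\<lbrakk>x \<in> carrier X; y \<in> carrier X\<rbrakk> \<Longrightarrow> x \<leadsto> y\<^sup>\<star> = y \<leadsto> x\<^sup>\<star>"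
  by (simp add: BE_compl_def imp_exchange bottom_closed)

lemma join_commute: "\<lbrakk>x \<in> carrier X; y \<in> carrier X\<rbrakk> \<Longrightarrow> x \<squnion> y = y \<squnion> x"
  using imp_compl_commute[of "x\<^sup>\<star>" "y\<^sup>\<star>"] by (simp add: join_def involutive)

lemma join_left_commute:
  "\<lbrakk>x \<in> carrier X; y \<in> carrier X; z \<in> carrier X\<rbrakk> \<Longrightarrow> x \<squnion> (y \<squnion> z) = y \<squnion> (x \<squnion> z)"
  by (simp add: join_def imp_exchange)

lemma join_assoc:
  assumes "x \<in> carrier X" "y \<in> carrier X" "z \<in> carrier X"
  shows "x \<squnion> y \<squnion> z = x \<squnion> (y \<squnion> z)"
  using assms by (metis join_closed join_commute join_left_commute)

lemma meet_commute: "\<lbrakk>x \<in> carrier X; y \<in> carrier X\<rbrakk> \<Longrightarrow> x \<sqdot> y = y \<sqdot> x"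
  by (simp add: meet_def imp_compl_commute)

lemma meet_assoc:
  assumes "x \<in> carrier X" "y \<in> carrier X" "z \<in> carrier X"
  shows "x \<sqdot> y \<sqdot> z = x \<sqdot> (y \<sqdot> z)"
proof -
  have "(x\<^sup>\<star> \<squnion> y\<^sup>\<star> \<squnion> z\<^sup>\<star>)\<^sup>\<star> = (x\<^sup>\<star> \<squnion> (y\<^sup>\<star> \<squnion> z\<^sup>\<star>))\<^sup>\<star>"
    using assms by (simp only: join_assoc compl_closed)
  then show ?thesis
    using assms by (simp add: involutive)
qed

text \<open>Implicativity at \<open>y\<^sup>\<star>\<close>: the antecedent
  \<open>x \<leadsto> y\<^sup>\<star>\<close> is the complement of \<open>x \<sqdot> y\<close>,
  which makes the outer implication a join.\<close>

lemma join_absorb: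
  assumes "x \<in> carrier X" "y \<in> carrier X"
  shows "x \<squnion> x \<sqdot> y = x"
proof -
  have "x \<sqdot> y \<squnion> x = x"
    using assms implicative[of x "y\<^sup>\<star>"] by (simp add: join_def meet_def involutive imp_closed)
  then show ?thesis
    using assms by (simp add: join_commute)
qed

lemma meet_absorb:
  assumes "x \<in> carrier X" "y \<in> carrier X"
  shows "x \<sqdot> (x \<squnion> y) = x"
  using arg_cong[OF join_absorb[of "x\<^sup>\<star>" "y\<^sup>\<star>"], of "\<lambda>u. u\<^sup>\<star>"] assms
  by (simp add: involutive)

lemma compl_bottom: "\<zero>\<^sup>\<star> = \<one>"
  by (simp add: BE_compl_def imp_refl bottom_closed)

lemma meet_unit: "x \<in> carrier X \<Longrightarrow> x \<sqdot> \<one> = x"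
  \<comment> \<open>Involutivity at the bottom and \<open>compl_bottom\<close> give
    \<open>\<one>\<^sup>\<star> = \<zero>\<close>, so the meet becomes the double complement of
    \<open>x\<close>.\<close>
  using involutive[OF bottom_closed] involutive[of x]
  by (simp add: meet_def compl_bottom flip: BE_compl_def)

lemma join_bottom: "x \<in> carrier X \<Longrightarrow> x \<squnion> \<zero> = x"
  by (simp add: join_def involutive flip: BE_compl_def)

lemma meet_compl: "x \<in> carrier X \<Longrightarrow> x \<sqdot> x\<^sup>\<star> = \<zero>"
  using involutive[OF bottom_closed]
  by (simp add: meet_def involutive imp_refl compl_bottom)

text \<open>From here on, \<open>a \<squnion> b = b\<close> expresses that \<open>a\<close> lies
  below \<open>b\<close>. Under this reading \<open>join_least\<close> and
  \<open>meet_greatest\<close> are the universal properties of join and meet.\<close>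

lemma join_least:
  assumes "x \<in> carrier X" "y \<in> carrier X" "z \<in> carrier X" "x \<squnion> z = z" "y \<squnion> z = z"
  shows "x \<squnion> y \<squnion> z = z"
  using assms by (simp add: join_assoc)

text \<open>Both directions are absorption. In meet form, order hypotheses combine by associativity
  of the meet, which yields \<open>meet_greatest\<close>.\<close>

lemma join_eq_iff_meet_eq:
  assumes "x \<in> carrier X" "y \<in> carrier X"
  shows "x \<squnion> y = y \<longleftrightarrow> x \<sqdot> y = x"
  using assms join_absorb[of y x] meet_absorb[of x y] by (metis join_commute meet_commute)

lemma meet_greatest:
  assumes "x \<in> carrier X" "y \<in> carrier X" "z \<in> carrier X" "z \<squnion> x = x" "z \<squnion> y = y"
  shows "z \<squnion> x \<sqdot> y = x \<sqdot> y"
  using assms by (simp add: join_eq_iff_meet_eq flip: meet_assoc)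

lemma join_self: "x \<in> carrier X \<Longrightarrow> x \<squnion> x = x"
  using join_absorb[of x "\<one>"] meet_unit[of x] by (simp add: unit_closed)

lemma Cap_eq: "x \<sqinter> y = (x \<squnion> y\<^sup>\<star>) \<sqdot> y"
  by (simp add: BE_Cap_def join_def meet_def)

lemma implicative_orthomodular_lattice_iff:
  "implicative_orthomodular_lattice X \<longleftrightarrow>
    (\<forall>x\<in>carrier X. \<forall>y\<in>carrier X. (x \<squnion> y) \<sqdot> (x \<squnion> (x \<squnion> y)\<^sup>\<star>) = x)"
proof -
  have "x \<sqinter> (y\<^sup>\<star> \<leadsto> x) = (x \<squnion> y) \<sqdot> (x \<squnion> (x \<squnion> y)\<^sup>\<star>)"
    if "x \<in> carrier X" "y \<in> carrier X" for x y
  proof -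
    have "y\<^sup>\<star> \<leadsto> x = x \<squnion> y"
      using that join_commute[of x y] by (simp add: join_def)
    then show ?thesis
      using that by (metis Cap_eq meet_commute join_closed compl_closed)
  qed
  \<comment> \<open>Complementation maps the carrier onto itself, so \<open>y\<close> may be
    replaced by \<open>y\<^sup>\<star>\<close> under the quantifier.\<close>
  then have "(\<forall>x\<in>carrier X. \<forall>y\<in>carrier X. x \<sqinter> (y \<leadsto> x) = x) \<longleftrightarrow>
      (\<forall>x\<in>carrier X. \<forall>y\<in>carrier X. (x \<squnion> y) \<sqdot> (x \<squnion> (x \<squnion> y)\<^sup>\<star>) = x)"
    by (metis compl_closed involutive)
  then show ?thesis
    using implicative_involutive_BE_algebra_axioms
    by (auto simp: implicative_orthomodular_lattice_def implicative_orthomodular_lattice_axioms_def)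
qed

text \<open>The orthomodular law as an equality test for comparable elements: by De Morgan
  \<open>w \<squnion> m\<^sup>\<star>\<close> is the unit, and the law at \<open>w\<close>,
  \<open>m\<close> shrinks to \<open>m \<sqdot> \<one> = w\<close>.\<close>

lemma orthomodular_eqI:
  assumes oml: "\<And>x y. \<lbrakk>x \<in> carrier X; y \<in> carrier X\<rbrakk> \<Longrightarrow> (x \<squnion> y) \<sqdot> (x \<squnion> (x \<squnion> y)\<^sup>\<star>) = x"
    and "w \<in> carrier X" "m \<in> carrier X" "w \<squnion> m = m" "m \<sqdot> w\<^sup>\<star> = \<zero>"
  shows "m = w"
proof -
  have "w \<squnion> m\<^sup>\<star> = (m \<sqdot> w\<^sup>\<star>)\<^sup>\<star>"
    using assms(2,3) by (simp add: involutive join_commute)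
  then have "w \<squnion> m\<^sup>\<star> = \<one>"
    using assms compl_bottom by simp
  then show ?thesis
    using oml[of w m] assms meet_unit by simp
qed

lemma orthomodular_distrib:
  assumes oml: "\<And>x y. \<lbrakk>x \<in> carrier X; y \<in> carrier X\<rbrakk> \<Longrightarrow> (x \<squnion> y) \<sqdot> (x \<squnion> (x \<squnion> y)\<^sup>\<star>) = x"
    and x: "x \<in> carrier X" and y: "y \<in> carrier X"
  shows "(x \<squnion> y\<^sup>\<star>) \<sqdot> (x \<squnion> y) = x \<squnion> (x \<squnion> y) \<sqdot> y\<^sup>\<star>"
proof (rule orthomodular_eqI[OF oml])
  let ?z = "x \<squnion> y" and ?v = "x \<squnion> y\<^sup>\<star>"
  have le_join: "a \<squnion> (a \<squnion> b) = a \<squnion> b" if "a \<in> carrier X" "b \<in> carrier X" for a b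
    using that join_assoc[of a a b] by (simp add: join_self)
  have meet_le: "a \<sqdot> b \<squnion> a = a" "a \<sqdot> b \<squnion> b = b" if "a \<in> carrier X" "b \<in> carrier X" for a b
    using that join_absorb[of a b] join_absorb[of b a]
    by (simp_all add: join_commute meet_commute)
  \<comment> \<open>The meet lies below \<open>y\<^sup>\<star>\<close>, which is a joinand of
    \<open>?v\<close>.\<close>
  have "?z \<sqdot> y\<^sup>\<star> \<squnion> ?v = ?v"
    using x y meet_le(2)[of ?z "y\<^sup>\<star>"] by (simp add: join_left_commute)
  then have "x \<squnion> ?z \<sqdot> y\<^sup>\<star> \<squnion> ?v = ?v"
    using x y by (simp add: join_least le_join)
  moreover have "x \<squnion> ?z \<sqdot> y\<^sup>\<star> \<squnion> ?z = ?z"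
    using x y by (simp add: join_least le_join meet_le)
  ultimately show "x \<squnion> ?z \<sqdot> y\<^sup>\<star> \<squnion> ?v \<sqdot> ?z = ?v \<sqdot> ?z"
    using x y by (simp add: meet_greatest)
  \<comment> \<open>The law with \<open>x\<close> and \<open>y\<close> exchanged; \<open>?z\<close>
    is symmetric in them.\<close>
  have oml_y: "?z \<sqdot> (?z\<^sup>\<star> \<squnion> y) = y"
    using oml[OF y x] x y by (metis join_commute join_closed compl_closed)
  have "(x \<squnion> ?z \<sqdot> y\<^sup>\<star>)\<^sup>\<star> = (?z\<^sup>\<star> \<squnion> y) \<sqdot> x\<^sup>\<star>"
    using x y by (simp add: involutive meet_commute join_commute)
  then have "(?v \<sqdot> ?z) \<sqdot> (x \<squnion> ?z \<sqdot> y\<^sup>\<star>)\<^sup>\<star> = ?v \<sqdot> (?z \<sqdot> (?z\<^sup>\<star> \<squnion> y) \<sqdot> x\<^sup>\<star>)"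
    using x y by (simp only: meet_assoc meet_closed join_closed compl_closed)
  \<comment> \<open>\<open>oml_y\<close> collapses the inner meet to \<open>y\<close>, and
    \<open>y \<sqdot> x\<^sup>\<star>\<close> is the complement of \<open>?v\<close>.\<close>
  also have "\<dots> = ?v \<sqdot> ?v\<^sup>\<star>"
    using x y by (simp only: oml_y) (simp add: involutive meet_commute)
  also have "\<dots> = \<zero>"
    using x y by (intro meet_compl) simp
  finally show "(?v \<sqdot> ?z) \<sqdot> (x \<squnion> ?z \<sqdot> y\<^sup>\<star>)\<^sup>\<star> = \<zero>" .
qed (use x y in auto)

lemma orthomodular_if_distrib:
  assumes distrib: "\<And>x y. \<lbrakk>x \<in> carrier X; y \<in> carrier X\<rbrakk>
      \<Longrightarrow> (x \<squnion> y\<^sup>\<star>) \<sqdot> (x \<squnion> y) = x \<squnion> (x \<squnion> y) \<sqdot> y\<^sup>\<star>"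
    and x: "x \<in> carrier X" and y: "y \<in> carrier X"
  shows "(x \<squnion> y) \<sqdot> (x \<squnion> (x \<squnion> y)\<^sup>\<star>) = x"
proof -
  let ?z = "x \<squnion> y"
  have "x \<squnion> ?z = ?z"
    using x y join_assoc[of x x y] by (simp add: join_self)
  \<comment> \<open>At \<open>?z\<close> both occurrences of \<open>x \<squnion> ?z\<close> collapse
    to \<open>?z\<close>, leaving on the right the meet of \<open>?z\<close> with its own
    complement.\<close>
  then have "(x \<squnion> ?z\<^sup>\<star>) \<sqdot> ?z = x \<squnion> ?z \<sqdot> ?z\<^sup>\<star>"
    using distrib[of x ?z] x y by simp
  also have "\<dots> = x"
    using x y meet_compl[of ?z] by (simp only: join_closed join_bottom)
  finally show ?thesis
    using x y by (metis meet_commute join_closed compl_closed)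
qed

end

theorem theorem6p1:
  fixes X :: "('a, 'm) BE_structure_scheme" (structure)
  assumes "implicative_involutive_BE_algebra X"
  shows "implicative_orthomodular_lattice X \<longleftrightarrow>
    (\<forall>x\<in>carrier X. \<forall>y\<in>carrier X.
      ((x\<^sup>\<star> \<leadsto> y\<^sup>\<star>) \<leadsto> (x\<^sup>\<star> \<leadsto> y)\<^sup>\<star>)\<^sup>\<star> = x\<^sup>\<star> \<leadsto> (x \<sqinter> y\<^sup>\<star>))"
proof -
  interpret implicative_involutive_BE_algebra X
    by (fact assms)
  have lhs: "((x\<^sup>\<star> \<leadsto> y\<^sup>\<star>) \<leadsto> (x\<^sup>\<star> \<leadsto> y)\<^sup>\<star>)\<^sup>\<star> = meet (join x (y\<^sup>\<star>)) (join x y)" for x y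
    by (simp add: join_def meet_def)
  have rhs: "x\<^sup>\<star> \<leadsto> (x \<sqinter> y\<^sup>\<star>) = join x (meet (join x y) (y\<^sup>\<star>))" if "y \<in> carrier X" for x y
    using that by (simp add: Cap_eq involutive flip: join_def)
  show ?thesis
    unfolding implicative_orthomodular_lattice_iff lhs
    \<comment> \<open>Without \<open>compl_join\<close> the complement of
      \<open>x \<squnion> y\<close> keeps the shape it has in both lemmas.\<close>
    using orthomodular_distrib orthomodular_if_distrib by (auto simp add: rhs simp del: compl_join)
qed

end
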